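(* Let $\alpha=\{\alpha_j\}_{j=0}^\infty\in\mathbb{D}^\infty$ and $\lambda\in\partial\mathbb{D}$. For $n=0,1,2,\dots$ define diagonal unitary matrices $U_n$ (rows and columns indexed by $0,1,2,\dots$) as follows: $U_{2k-1}$ ($k\ge1$) has diagonal entries consisting of $2k$ entries equal to $1$ followed by the infinite alternating sequence $1,\lambda,1,\lambda,\dots$; and $U_{2k}$ ($k\ge0$) has diagonal entries consisting of $2k$ entries equal to $\lambda$ followed by the infinite alternating sequence $1,\lambda,1,\lambda,\dots$. Then for every $n=0,1,2,\dots$, $$U_n\,\mathcal{C}(T_{n,\lambda^{-1}}(\alpha))\,U_n^{-1}=\mathcal{C}(\alpha)\,\Delta_n(\lambda),$$ where $\Delta_n(\lambda)$ is the diagonal matrix whose diagonal entry at index $n$ is $\lambda$ and whose other diagonal entries are all $1$ (so there are $n$ entries $1$ preceding $\lambda$).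
   Context: $\mathbb{D}=\{z\in\mathbb{C}:|z|<1\}$, $\mathbb{D}^\infty=\prod_{j=0}^\infty\mathbb{D}$, and $\partial\mathbb{D}$ is the unit circle. CMV matrix: for $\alpha\in\mathbb{D}$ let $\rho=(1-|\alpha|^2)^{1/2}$ and $\Theta(\alpha)=\begin{pmatrix}\bar\alpha&\rho\\ \rho&-\alpha\end{pmatrix}$. For a sequence $\alpha=\{\alpha_j\}_{j=0}^\infty\in\mathbb{D}^\infty$ define the unitary operators on $\ell^2(\{0,1,2,\dots\})$, written as matrices in the standard basis $\{\delta_j\}_{j=0}^\infty$, $$\mathcal{L}(\alpha)=\Theta(\alpha_0)\oplus\Theta(\alpha_2)\oplus\Theta(\alpha_4)\oplus\cdots,\qquad \mathcal{M}(\alpha)=\mathbf{1}_1\oplus\Theta(\alpha_1)\oplus\Theta(\alpha_3)\oplus\cdots,$$ where $\mathbf{1}_1$ is the $1\times1$ identity matrix. The CMV matrix is $\mathcal{C}(\alpha)=\mathcal{L}(\alpha)\mathcal{M}(\alpha)$. For $n=0,1,2,\dots$ and $\lambda\in\partial\mathbb{D}$, the map $T_{n,\lambda}:\mathbb{D}^\infty\to\mathbb{D}^\infty$ is defined by $(T_{n,\lambda}(\alpha))_j=\alpha_j$ for $0\le j\le n-1$ and $(T_{n,\lambda}(\alpha))_j=\lambda\alpha_j$ for $j\ge n$. *)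

theory Defs
  imports "HOL-Analysis.Analysis"
begin

text \<open>
  Operators on \<open>\<ell>\<^sup>2({0,1,2,\<dots>})\<close> are given by their matrices in the standard basis.
  The matrix of a composition \<open>A B\<close> of bounded operators has the entries
  \<open>\<langle>\<delta>\<^sub>i, A B \<delta>\<^sub>j\<rangle> = \<Sum>k. A\<^sub>i\<^sub>k B\<^sub>k\<^sub>j\<close>, an absolutely convergent series.
\<close>

type_synonym imat = "nat \<Rightarrow> nat \<Rightarrow> complex"

definition imat_mult :: "imat \<Rightarrow> imat \<Rightarrow> imat"  (infixl "\<odot>" 70) where
  "A \<odot> B = (\<lambda>i j. \<Sum>\<^sub>\<infinity>k. A i k * B k j)"

definition imat_diag :: "(nat \<Rightarrow> complex) \<Rightarrow> imat" where
  "imat_diag d = (\<lambda>i j. if i = j then d i else 0)"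

definition imat_one :: imat where
  "imat_one = imat_diag (\<lambda>_. 1)"

definition imat_adjoint :: "imat \<Rightarrow> imat" where
  "imat_adjoint A = (\<lambda>i j. cnj (A j i))"

definition imat_unitary :: "imat \<Rightarrow> bool" where
  "imat_unitary A \<longleftrightarrow> A \<odot> imat_adjoint A = imat_one \<and> imat_adjoint A \<odot> A = imat_one"

text \<open>
  Two-sided inverses of infinite matrices need not be unique in general. For diagonal matrices
  with nonzero entries they are: see \<open>imat_inv_diag\<close> below.
\<close>

definition imat_inv :: "imat \<Rightarrow> imat" where
  "imat_inv A = (THE B. A \<odot> B = imat_one \<and> B \<odot> A = imat_one)"

definition rho :: "complex \<Rightarrow> real" where
  "rho a = sqrt (1 - (cmod a)\<^sup>2)"

definition Theta :: "complex \<Rightarrow> complex ^ 2 ^ 2" where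
  "Theta a = vector [vector [cnj a, of_real (rho a)],
                     vector [of_real (rho a), - a]]"

text \<open>
  \<open>dsum B\<close> is \<open>B 0 \<oplus> B 1 \<oplus> B 2 \<oplus> \<dots>\<close>: the block \<open>B m\<close> occupies the rows and columns
  \<open>2m, 2m+1\<close>, which are its rows and columns \<open>1, 2\<close> in the indexing of \<open>complex ^ 2 ^ 2\<close>.
\<close>

definition block_index :: "nat \<Rightarrow> 2" where
  "block_index i = (if even i then 1 else 2)"

definition dsum :: "(nat \<Rightarrow> complex ^ 2 ^ 2) \<Rightarrow> imat" where
  "dsum B = (\<lambda>i j. if i div 2 = j div 2
                    then B (i div 2) $ block_index i $ block_index j else 0)"

text \<open>The direct sum of the \<open>1 \<times> 1\<close> identity matrix with \<open>A\<close>.\<close>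

fun one_dsum :: "imat \<Rightarrow> imat" where
  "one_dsum A 0 0 = 1"
| "one_dsum A 0 (Suc j) = 0"
| "one_dsum A (Suc i) 0 = 0"
| "one_dsum A (Suc i) (Suc j) = A i j"

definition CMV_L :: "(nat \<Rightarrow> complex) \<Rightarrow> imat" where
  "CMV_L \<alpha> = dsum (\<lambda>m. Theta (\<alpha> (2 * m)))"

definition CMV_M :: "(nat \<Rightarrow> complex) \<Rightarrow> imat" where
  "CMV_M \<alpha> = one_dsum (dsum (\<lambda>m. Theta (\<alpha> (2 * m + 1))))"

definition CMV :: "(nat \<Rightarrow> complex) \<Rightarrow> imat" where
  "CMV \<alpha> = CMV_L \<alpha> \<odot> CMV_M \<alpha>"

definition T :: "nat \<Rightarrow> complex \<Rightarrow> (nat \<Rightarrow> complex) \<Rightarrow> nat \<Rightarrow> complex" where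
  "T n l \<alpha> = (\<lambda>j. if j < n then \<alpha> j else l * \<alpha> j)"

text \<open>The sequence \<open>1, l, 1, l, \<dots>\<close>.\<close>

definition alternating :: "complex \<Rightarrow> nat \<Rightarrow> complex" where
  "alternating l j = (if even j then 1 else l)"

text \<open>
  For \<open>n = 2k\<close> there are \<open>2k = n\<close> leading entries \<open>l\<close>; for \<open>n = 2k - 1\<close> there are
  \<open>2k = n + 1\<close> leading entries \<open>1\<close>. The alternating sequence follows in both cases.
\<close>

definition U_entry :: "nat \<Rightarrow> complex \<Rightarrow> nat \<Rightarrow> complex" where
  "U_entry n l j =
     (if even n then (if j < n then l else alternating l (j - n))
      else (if j < n + 1 then 1 else alternating l (j - (n + 1))))"

definition U :: "nat \<Rightarrow> complex \<Rightarrow> imat" where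
  "U n l = imat_diag (U_entry n l)"

definition Delta :: "nat \<Rightarrow> complex \<Rightarrow> imat" where
  "Delta n l = imat_diag (\<lambda>j. if j = n then l else 1)"

lemma imat_diag_mult: "imat_diag d \<odot> A = (\<lambda>i j. d i * A i j)"
proof (intro ext)
  fix i j
  have "(imat_diag d \<odot> A) i j = (\<Sum>\<^sub>\<infinity>k\<in>{i}. imat_diag d i k * A k j)"
    unfolding imat_mult_def by (rule infsum_cong_neutral) (auto simp: imat_diag_def)
  then show "(imat_diag d \<odot> A) i j = d i * A i j"
    by (simp add: imat_diag_def)
qed

lemma mult_imat_diag: "A \<odot> imat_diag d = (\<lambda>i j. A i j * d j)"
proof (intro ext)
  fix i j
  have "(A \<odot> imat_diag d) i j = (\<Sum>\<^sub>\<infinity>k\<in>{j}. A i k * imat_diag d k j)"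
    unfolding imat_mult_def by (rule infsum_cong_neutral) (auto simp: imat_diag_def)
  then show "(A \<odot> imat_diag d) i j = A i j * d j"
    by (simp add: imat_diag_def)
qed

lemma imat_diag_mult_diag: "imat_diag d \<odot> imat_diag e = imat_diag (\<lambda>j. d j * e j)"
  unfolding imat_diag_mult by (auto simp: imat_diag_def fun_eq_iff)

lemma imat_inv_diag:
  assumes "\<And>j. d j \<noteq> 0"
  shows "imat_inv (imat_diag d) = imat_diag (\<lambda>j. inverse (d j))"
  unfolding imat_inv_def
proof (rule the_equality)
  show "imat_diag d \<odot> imat_diag (\<lambda>j. inverse (d j)) = imat_one \<and>
        imat_diag (\<lambda>j. inverse (d j)) \<odot> imat_diag d = imat_one"
    using assms by (simp add: imat_diag_mult_diag imat_one_def)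
next
  fix B
  assume "imat_diag d \<odot> B = imat_one \<and> B \<odot> imat_diag d = imat_one"
  then have "(\<lambda>i j. d i * B i j) = imat_one"
    by (simp add: imat_diag_mult)
  then have *: "d i * B i j = (if i = j then 1 else 0)" for i j
    by (simp add: imat_one_def imat_diag_def fun_eq_iff)
  show "B = imat_diag (\<lambda>j. inverse (d j))"
  proof (intro ext)
    fix i j
    show "B i j = imat_diag (\<lambda>j. inverse (d j)) i j"
      using *[of i j] assms[of i] by (auto simp: imat_diag_def field_simps split: if_splits)
  qed
qed

lemma cmod_U_entry:
  assumes "cmod l = 1"
  shows "cmod (U_entry n l j) = 1"
  using assms by (simp add: U_entry_def alternating_def)

lemma imat_unitary_U:
  assumes "l \<in> sphere 0 1"
  shows "imat_unitary (U n l)"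
proof -
  have "U_entry n l j * cnj (U_entry n l j) = 1" for j
    using cmod_U_entry[of l n j] assms by (simp add: complex_norm_square[symmetric])
  moreover have "imat_adjoint (U n l) = imat_diag (\<lambda>j. cnj (U_entry n l j))"
    by (auto simp: imat_adjoint_def U_def imat_diag_def fun_eq_iff)
  ultimately show ?thesis
    by (simp add: imat_unitary_def U_def imat_diag_mult_diag imat_one_def mult.commute)
qed

lemma imat_inv_U:
  assumes "l \<in> sphere 0 1"
  shows "U n l \<odot> imat_inv (U n l) = imat_one" "imat_inv (U n l) \<odot> U n l = imat_one"
proof -
  have nz: "U_entry n l j \<noteq> 0" for j
    using cmod_U_entry[of l n j] assms by auto
  have "imat_inv (U n l) = imat_diag (\<lambda>j. inverse (U_entry n l j))"
    unfolding U_def by (rule imat_inv_diag) (rule nz)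
  then show "U n l \<odot> imat_inv (U n l) = imat_one" "imat_inv (U n l) \<odot> U n l = imat_one"
    using nz by (simp_all add: U_def imat_diag_mult_diag imat_one_def)
qed

lemma T_in_disc:
  assumes "\<And>j. \<alpha> j \<in> ball 0 1" "l \<in> sphere 0 1"
  shows "T n l \<alpha> j \<in> ball 0 1"
  using assms by (simp add: T_def norm_mult)

end

theory Submission
  imports Defs
begin

text \<open>
  For \<open>|\<mu>| = 1\<close>, rotating a coefficient by \<open>\<mu>\<close> changes only the diagonal of its block \<open>\<Theta>\<close>, since
  \<open>\<rho>\<close> depends on the modulus alone. A diagonal matrix absorbs this change, provided that its two
  entries are exchanged on passing through the block:
  \<open>diag(x, y) \<Theta>(\<mu> a) = \<Theta>(a) diag(y, x)\<close> whenever \<open>y = cnj \<mu> * x\<close>. For \<open>\<mu> = 1\<close> these are the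
  scalar matrices, and for \<open>\<mu> = \<lambda>\<inverse>\<close> they are the multiples of \<open>diag(1, \<lambda>)\<close>.

  The diagonal of \<open>U\<^sub>n\<close> satisfies this condition on all the blocks \<open>{2m, 2m+1}\<close> of \<open>\<L>\<close> at once, so
  \<open>U\<^sub>n\<close> passes through \<open>\<L>\<close> (lemma \<open>U_CMV_L\<close>) and comes out as the matrix \<open>W\<^sub>n\<close> in which the entries
  at \<open>2m\<close> and \<open>2m+1\<close> have been exchanged. The diagonal of \<open>W\<^sub>n\<close> satisfies the condition on
  the blocks \<open>{2m+1, 2m+2}\<close> of \<open>\<M>\<close>, so it passes through \<open>\<M>\<close> as well (lemma \<open>W_CMV_M\<close>). After the
  second exchange the diagonal has returned to that of \<open>U\<^sub>n\<close>, except for a factor \<open>\<lambda>\<close> at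
  the index \<open>n\<close> where the rotation of the coefficients sets in: this is \<open>\<Delta>\<^sub>n(\<lambda>) U\<^sub>n\<close>. Multiplying by
  \<open>U\<^sub>n\<inverse>\<close> from the right gives the theorem.
\<close>

text \<open>
  The product of infinite matrices is not associative in general, because the two iterated sums
  may differ. With a diagonal factor one of the two sums has a single term.
\<close>

lemma diag_mult_assoc: "imat_diag d \<odot> A \<odot> B = imat_diag d \<odot> (A \<odot> B)"
  unfolding imat_diag_mult
  by (simp add: imat_mult_def mult.assoc infsum_cmult_right')

lemma mult_diag_assoc: "A \<odot> B \<odot> imat_diag d = A \<odot> (B \<odot> imat_diag d)"
  unfolding mult_imat_diag
  by (simp add: imat_mult_def mult.assoc[symmetric] infsum_cmult_left')

lemma mult_diag_mult_assoc: "A \<odot> imat_diag d \<odot> B = A \<odot> (imat_diag d \<odot> B)"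
  unfolding mult_imat_diag imat_diag_mult
  by (simp add: imat_mult_def mult.assoc)

lemma rho_rotate: "cmod \<mu> = 1 \<Longrightarrow> rho (\<mu> * a) = rho a"
  by (simp add: rho_def norm_mult)

lemma cnj_inverse_unit:
  assumes "cmod z = 1"
  shows "cnj (inverse z) = z"
proof -
  have "cnj z * z = 1"
    using assms by (simp add: complex_norm_square[symmetric] mult.commute[of "cnj z"])
  then show ?thesis
    by (simp add: inverse_unique)
qed

lemma Theta_nth:
  "Theta a $ 1 $ 1 = cnj a" "Theta a $ 1 $ 2 = of_real (rho a)"
  "Theta a $ 2 $ 1 = of_real (rho a)" "Theta a $ 2 $ 2 = - a"
  by (simp_all add: Theta_def)

text \<open>
  The off-diagonal entries \<open>\<rho>\<close> of a block force the exchange \<open>y\<^sub>2\<^sub>m = x\<^sub>2\<^sub>m\<^sub>+\<^sub>1\<close>,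
  \<open>y\<^sub>2\<^sub>m\<^sub>+\<^sub>1 = x\<^sub>2\<^sub>m\<close>, and the diagonal entries then force the ratio of \<open>x\<^sub>2\<^sub>m\<^sub>+\<^sub>1\<close> to \<open>x\<^sub>2\<^sub>m\<close>.
\<close>

lemma diag_dsum_Theta:
  assumes \<mu>: "\<And>m. cmod (\<mu> m) = 1"
    and ratio: "\<And>m. x (2 * m + 1) = cnj (\<mu> m) * x (2 * m)"
    and swap: "\<And>m. y (2 * m) = x (2 * m + 1)" "\<And>m. y (2 * m + 1) = x (2 * m)"
  shows "imat_diag x \<odot> dsum (\<lambda>m. Theta (\<mu> m * a m)) = dsum (\<lambda>m. Theta (a m)) \<odot> imat_diag y"
proof -
  have "x i * dsum (\<lambda>m. Theta (\<mu> m * a m)) i j = dsum (\<lambda>m. Theta (a m)) i j * y j" for i j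
  proof (cases "i div 2 = j div 2")
    case True
    define m where "m = i div 2"
    have "\<mu> m * cnj (\<mu> m) = 1"
      using \<mu>[of m] by (simp add: complex_norm_square[symmetric])
    then have cancel: "cnj (\<mu> m) * (\<mu> m * z) = z" for z
      by (simp add: mult.assoc[symmetric] mult.commute[of "cnj (\<mu> m)"])
    have "i = 2 * m \<or> i = 2 * m + 1" "j = 2 * m \<or> j = 2 * m + 1"
      using True unfolding m_def by presburger+
    then show ?thesis
      using swap[of m] ratio[of m] cancel
      by (auto simp: dsum_def block_index_def Theta_nth rho_rotate[OF \<mu>] ac_simps)
  qed (simp add: dsum_def)
  then show ?thesis
    by (simp add: imat_diag_mult mult_imat_diag)
qed

text \<open>Behind the \<open>1 \<times> 1\<close> block a diagonal matrix acts through its entries from index 1 on.\<close>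

lemma diag_one_dsum:
  assumes tail: "imat_diag (\<lambda>j. x (Suc j)) \<odot> A = B \<odot> imat_diag (\<lambda>j. y (Suc j))"
    and "x 0 = y 0"
  shows "imat_diag x \<odot> one_dsum A = one_dsum B \<odot> imat_diag y"
proof -
  have "x (Suc i) * A i j = B i j * y (Suc j)" for i j
    using tail by (simp add: imat_diag_mult mult_imat_diag fun_eq_iff)
  then have "x i * one_dsum A i j = one_dsum B i j * y j" for i j
    using \<open>x 0 = y 0\<close> by (cases i; cases j) auto
  then show ?thesis
    by (simp add: imat_diag_mult mult_imat_diag)
qed

text \<open>
  The diagonal that lies between the factors \<open>\<L>\<close> and \<open>\<M>\<close> when \<open>U\<close> is moved through their product.
\<close>

definition W_entry :: "nat \<Rightarrow> complex \<Rightarrow> nat \<Rightarrow> complex" where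
  "W_entry n l j = U_entry n l (if even j then j + 1 else j - 1)"

text \<open>
  Up to the index \<open>n\<close> the diagonal of \<open>U\<close> is constant on the blocks of \<open>\<L>\<close>, as the unrotated
  coefficients require. From there on it reads \<open>1, l\<close> on each block, which is the ratio for
  coefficients rotated by \<open>l\<inverse>\<close>. The change occurs at an even index for either parity of \<open>n\<close>.
\<close>

lemma U_CMV_L:
  assumes "cmod l = 1"
  shows "U n l \<odot> CMV_L (T n (inverse l) \<alpha>) = CMV_L \<alpha> \<odot> imat_diag (W_entry n l)"
proof -
  define \<mu> where "\<mu> m = (if 2 * m < n then 1 else inverse l)" for m
  have "cnj (inverse l) = l"
    using assms by (rule cnj_inverse_unit)
  then have "U_entry n l (2 * m + 1) = cnj (\<mu> m) * U_entry n l (2 * m)" for m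
    by (auto simp: \<mu>_def U_entry_def alternating_def; presburger)
  moreover have "cmod (\<mu> m) = 1" for m
    using assms by (simp add: \<mu>_def norm_inverse)
  ultimately have "U n l \<odot> dsum (\<lambda>m. Theta (\<mu> m * \<alpha> (2 * m)))
      = dsum (\<lambda>m. Theta (\<alpha> (2 * m))) \<odot> imat_diag (W_entry n l)"
    unfolding U_def by (intro diag_dsum_Theta) (simp_all add: W_entry_def)
  moreover have "T n (inverse l) \<alpha> (2 * m) = \<mu> m * \<alpha> (2 * m)" for m
    by (simp add: T_def \<mu>_def)
  ultimately show ?thesis
    by (simp add: CMV_L_def)
qed

text \<open>
  Exchanging entries within the blocks of \<open>\<L>\<close> and then within those of \<open>\<M>\<close> shifts the
  entries at even indices by \<open>2\<close> in one direction and those at odd indices by \<open>2\<close> in the other. As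
  the diagonal of \<open>U\<close> is 2-periodic on either side of its break, the shift is visible only
  there: it moves one entry \<open>l\<close> across the break, and this entry lands at \<open>n\<close>. For \<open>n = 0\<close>, when
  nothing precedes the break, it is the entry \<open>l\<close> at the index 1 that is carried to the index 0.
\<close>

lemma W_CMV_M:
  assumes "cmod l = 1"
  shows "imat_diag (W_entry n l) \<odot> CMV_M (T n (inverse l) \<alpha>) = CMV_M \<alpha> \<odot> (Delta n l \<odot> U n l)"
proof -
  define \<mu> where "\<mu> m = (if 2 * m + 1 < n then 1 else inverse l)" for m
  define v where "v j = (if j = n then l else 1) * U_entry n l j" for j
  have "cnj (inverse l) = l"
    using assms by (rule cnj_inverse_unit)
  then have ratio: "W_entry n l (Suc (2 * m + 1)) = cnj (\<mu> m) * W_entry n l (Suc (2 * m))" for m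
    by (auto simp: \<mu>_def W_entry_def U_entry_def alternating_def; presburger)
  have swap: "v (Suc (2 * m)) = W_entry n l (Suc (2 * m + 1))"
      "v (Suc (2 * m + 1)) = W_entry n l (Suc (2 * m))" for m
    by (auto simp: v_def W_entry_def U_entry_def alternating_def; presburger)+
  have "cmod (\<mu> m) = 1" for m
    using assms by (simp add: \<mu>_def norm_inverse)
  then have "imat_diag (\<lambda>j. W_entry n l (Suc j)) \<odot> dsum (\<lambda>m. Theta (\<mu> m * \<alpha> (2 * m + 1)))
      = dsum (\<lambda>m. Theta (\<alpha> (2 * m + 1))) \<odot> imat_diag (\<lambda>j. v (Suc j))"
    using ratio swap by (intro diag_dsum_Theta)
  moreover have "W_entry n l 0 = v 0"
    by (auto simp: v_def W_entry_def U_entry_def alternating_def; presburger)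
  ultimately have "imat_diag (W_entry n l) \<odot> one_dsum (dsum (\<lambda>m. Theta (\<mu> m * \<alpha> (2 * m + 1))))
      = one_dsum (dsum (\<lambda>m. Theta (\<alpha> (2 * m + 1)))) \<odot> imat_diag v"
    by (rule diag_one_dsum)
  moreover have "T n (inverse l) \<alpha> (2 * m + 1) = \<mu> m * \<alpha> (2 * m + 1)" for m
    by (simp add: T_def \<mu>_def)
  moreover have "Delta n l \<odot> U n l = imat_diag v"
    by (simp add: Delta_def U_def imat_diag_mult_diag v_def[abs_def])
  ultimately show ?thesis
    by (simp add: CMV_M_def)
qed

theorem theorem5p1:
  fixes \<alpha> :: "nat \<Rightarrow> complex" and l :: complex and n :: nat
  assumes "\<And>j. \<alpha> j \<in> ball 0 1"
    and "l \<in> sphere 0 1"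
  shows "U n l \<odot> CMV (T n (inverse l) \<alpha>) \<odot> imat_inv (U n l) = CMV \<alpha> \<odot> Delta n l"
proof -
  let ?\<beta> = "T n (inverse l) \<alpha>" and ?W = "imat_diag (W_entry n l)"
  have l: "cmod l = 1"
    using assms(2) by simp
  have "U n l \<odot> CMV ?\<beta> = U n l \<odot> CMV_L ?\<beta> \<odot> CMV_M ?\<beta>"
    by (simp add: CMV_def U_def diag_mult_assoc)
  also have "\<dots> = CMV_L \<alpha> \<odot> (?W \<odot> CMV_M ?\<beta>)"
    by (simp add: U_CMV_L[OF l] mult_diag_mult_assoc)
  also have "\<dots> = CMV \<alpha> \<odot> (Delta n l \<odot> U n l)"
    by (simp add: W_CMV_M[OF l] CMV_def Delta_def U_def imat_diag_mult_diag mult_diag_assoc)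
  finally have "U n l \<odot> CMV ?\<beta> = CMV \<alpha> \<odot> Delta n l \<odot> U n l"
    by (simp add: U_def mult_diag_assoc)
  then have "U n l \<odot> CMV ?\<beta> \<odot> imat_inv (U n l) = CMV \<alpha> \<odot> Delta n l \<odot> (U n l \<odot> imat_inv (U n l))"
    by (simp add: U_def mult_diag_mult_assoc)
  also have "\<dots> = CMV \<alpha> \<odot> Delta n l"
    by (simp add: imat_inv_U[OF assms(2)] imat_one_def mult_imat_diag)
  finally show ?thesis .
qed

end
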